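(* Let $(X,\mathrm{d})$ be a countable compact metric space. There exists a finite approximative sequence (FAS) $\{U_{2\varepsilon_n}(A_n),p_{n,n+1}\}_{n\in\mathbb{N}}$ of $X$ whose inverse limit $\mathcal{X}$ is homeomorphic to $X$.
   Context: Let $(X,\mathrm{d})$ be a compact metric space. Hyperspaces: $2^X$ is the set of non-empty closed subsets of $X$. The upper semifinite topology on $2^X$ has as base the sets $B(U)=\{C\in 2^X: C\subset U\}$, $U\subset X$ open; the resulting space is $2^X_u$. If $A\subset X$ is finite and non-empty, $2^A_u$ is the (finite) set of non-empty subsets of $A$ with the upper semifinite topology, i.e. the topology with base the sets $2^C=\{D: \emptyset\neq D\subset C\}$, $\emptyset\ne C\subset A$. For $\varepsilon>0$, $U_{2\varepsilon}(A)=\{C\in 2^A:\operatorname{diam}(C)<2\varepsilon\}\subset 2^A_u$ with the subspace topology. Approximations: A finite subset $A\subset X$ is a finite $\varepsilon$-approximation of $X$ if for every $x\in X$ there is $a\in A$ with $\mathrm{d}(x,a)<\varepsilon$. For $x\in X$ put $A(x)=\{a\in A:\mathrm{d}(x,a)=\mathrm{d}(x,A)\}$ and, for $C\in 2^X$, $r_A(C)=\bigcup_{c\in C}A(c)$. If $A$ is a finite $\varepsilon$-approximation, let $\gamma=\sup\{\mathrm{d}(x,A):x\in X\}$ (so $\gamma<\varepsilon$). A number $0<\varepsilon'<\varepsilon$ is adjusted to $A$ if $\varepsilon'<\frac{\varepsilon-\gamma}{2}$. In that case, for every finite $\varepsilon'$-approximation $A'$, the map $p:U_{2\varepsilon'}(A')\to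 U_{2\varepsilon}(A)$, $p(C)=r_A(C)$, is well defined and continuous. FAS: A finite approximative sequence of $X$ is an inverse sequence $\{U_{2\varepsilon_n}(A_n),p_{n,n+1}\}_{n\in\mathbb{N}}$ (with $n\geq 1$), where $\{\varepsilon_n\}$ is a sequence of positive reals converging to zero, each $A_n$ is a finite $\varepsilon_n$-approximation of $X$, $\varepsilon_{n+1}$ is adjusted to $A_n$ for every $n$, and $p_{n,n+1}:U_{2\varepsilon_{n+1}}(A_{n+1})\to U_{2\varepsilon_n}(A_n)$ is $p_{n,n+1}(C)=r_{A_n}(C)$. Its inverse limit $\mathcal{X}$ is the subspace of $\prod_n U_{2\varepsilon_n}(A_n)$ of sequences $\{C_n\}$ with $p_{n,n+1}(C_{n+1})=C_n$ for all $n$. *)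

theory Defs
  imports "HOL-Analysis.Analysis"
begin

text \<open>Spaces are subsets \<open>X\<close> of an ambient metric space type; \<^const>\<open>infdist\<close> is the distance to a set
  and \<^const>\<open>diameter\<close> the diameter.\<close>

definition finite_hyperspace :: "'a set \<Rightarrow> 'a set topology" where
  "finite_hyperspace A = topology_generated_by {Pow C - {{}} | C. C \<noteq> {} \<and> C \<subseteq> A}"

text \<open>The generating sets form a base, not just a subbase: the open sets are the sets of
  non-empty subsets of \<open>A\<close> that are closed under passing to non-empty subsets.\<close>

lemma openin_finite_hyperspace:
  "openin (finite_hyperspace A) S \<longleftrightarrow> S \<subseteq> Pow A - {{}} \<and> (\<forall>D\<in>S. Pow D - {{}} \<subseteq> S)"
  (is "?L \<longleftrightarrow> ?R")
proof
  assume ?L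
  then have "generate_topology_on {Pow C - {{}} | C. C \<noteq> {} \<and> C \<subseteq> A} S"
    by (simp add: finite_hyperspace_def openin_topology_generated_by)
  then show ?R
  proof induction
    case (UN K)
    then show ?case by (meson Sup_least Sup_upper UnionE order_trans)
  qed blast+
next
  assume R: ?R
  have "openin (finite_hyperspace A) (Pow D - {{}})" if "D \<in> S" for D
    unfolding finite_hyperspace_def using R that
    by (intro topology_generated_by_Basis) blast
  then have "openin (finite_hyperspace A) (\<Union>D\<in>S. Pow D - {{}})"
    by blast
  moreover have "(\<Union>D\<in>S. Pow D - {{}}) = S"
    using R by blast
  ultimately show ?L by simp
qed

lemma topspace_finite_hyperspace: "topspace (finite_hyperspace A) = Pow A - {{}}"
proof
  show "topspace (finite_hyperspace A) \<subseteq> Pow A - {{}}"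
    using openin_finite_hyperspace openin_topspace by metis
  have "openin (finite_hyperspace A) (Pow A - {{}})"
    by (auto simp: openin_finite_hyperspace)
  then show "Pow A - {{}} \<subseteq> topspace (finite_hyperspace A)"
    by (rule openin_subset)
qed

definition small_hyperspace :: "real \<Rightarrow> 'a::metric_space set \<Rightarrow> 'a set topology" where
  "small_hyperspace \<delta> A = subtopology (finite_hyperspace A) {C. diameter C < \<delta>}"

definition finite_approximation :: "real \<Rightarrow> 'a::metric_space set \<Rightarrow> 'a set \<Rightarrow> bool" where
  "finite_approximation \<epsilon> X A \<longleftrightarrow> finite A \<and> A \<subseteq> X \<and> (\<forall>x\<in>X. \<exists>a\<in>A. dist x a < \<epsilon>)"

definition nearest_points :: "'a::metric_space set \<Rightarrow> 'a \<Rightarrow> 'a set" where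
  "nearest_points A x = {a \<in> A. dist x a = infdist x A}"

definition nearest_map :: "'a::metric_space set \<Rightarrow> 'a set \<Rightarrow> 'a set" where
  "nearest_map A C = (\<Union>c\<in>C. nearest_points A c)"

text \<open>The supremum is taken in \<open>[0,\<infinity>)\<close>. The extra \<open>0\<close> only fixes its value when \<open>X\<close> is empty.\<close>

definition approximation_radius :: "'a::metric_space set \<Rightarrow> 'a set \<Rightarrow> real" where
  "approximation_radius X A = Sup (insert 0 ((\<lambda>x. infdist x A) ` X))"

definition adjusted :: "'a::metric_space set \<Rightarrow> real \<Rightarrow> 'a set \<Rightarrow> real \<Rightarrow> bool" where
  "adjusted X \<epsilon> A \<epsilon>' \<longleftrightarrow> 0 < \<epsilon>' \<and> \<epsilon>' < \<epsilon> \<and> \<epsilon>' < (\<epsilon> - approximation_radius X A) / 2"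

text \<open>A finite approximative sequence is determined by the numbers \<open>\<epsilon> n\<close> and the sets \<open>A n\<close>: its
  \<open>n\<close>-th space is \<open>small_hyperspace (2 * \<epsilon> n) (A n)\<close> and its bonding map from stage \<open>Suc n\<close> to
  stage \<open>n\<close> is \<open>nearest_map (A n)\<close>. Indices start at \<open>0\<close>.\<close>

definition finite_approximative_sequence ::
  "'a::metric_space set \<Rightarrow> (nat \<Rightarrow> real) \<Rightarrow> (nat \<Rightarrow> 'a set) \<Rightarrow> bool" where
  "finite_approximative_sequence X \<epsilon> A \<longleftrightarrow>
     (\<forall>n. 0 < \<epsilon> n) \<and> \<epsilon> \<longlonglongrightarrow> 0 \<and>
     (\<forall>n. finite_approximation (\<epsilon> n) X (A n)) \<and>
     (\<forall>n. adjusted X (\<epsilon> n) (A n) (\<epsilon> (Suc n)))"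

definition inverse_limit :: "(nat \<Rightarrow> 'b topology) \<Rightarrow> (nat \<Rightarrow> 'b \<Rightarrow> 'b) \<Rightarrow> (nat \<Rightarrow> 'b) topology" where
  "inverse_limit T p =
     subtopology (product_topology T UNIV) {C. \<forall>n. p n (C (Suc n)) = C n}"

definition fas_limit ::
  "(nat \<Rightarrow> real) \<Rightarrow> (nat \<Rightarrow> 'a::metric_space set) \<Rightarrow> (nat \<Rightarrow> 'a set) topology" where
  "fas_limit \<epsilon> A =
     inverse_limit (\<lambda>n. small_hyperspace (2 * \<epsilon> n) (A n)) (\<lambda>n. nearest_map (A n))"

text \<open>The bonding maps are well defined and continuous.\<close>

lemma infdist_le_approximation_radius:
  assumes "finite_approximation \<epsilon> X A" "x \<in> X"
  shows "infdist x A \<le> approximation_radius X A"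
proof -
  have "infdist y A \<le> max 0 \<epsilon>" if "y \<in> X" for y
    using assms(1) that infdist_le2 unfolding finite_approximation_def
    by (metis less_imp_le max.coboundedI2)
  then have "bdd_above (insert 0 ((\<lambda>x. infdist x A) ` X))"
    by (intro bdd_aboveI[of _ "max 0 \<epsilon>"]) auto
  then show ?thesis
    unfolding approximation_radius_def using assms(2) by (intro cSup_upper) auto
qed

lemma continuous_map_nearest_map:
  fixes X :: "'a::metric_space set"
  assumes A: "finite_approximation \<epsilon> X A" and A': "finite_approximation \<epsilon>' X A'"
    and adj: "adjusted X \<epsilon> A \<epsilon>'"
  shows "continuous_map (small_hyperspace (2 * \<epsilon>') A') (small_hyperspace (2 * \<epsilon>) A) (nearest_map A)"
proof -
  let ?\<gamma> = "approximation_radius X A"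
  have fin: "finite A" "finite A'" and sub: "A' \<subseteq> X"
    using A A' by (auto simp: finite_approximation_def)
  have nonempty: "nearest_map A C \<noteq> {}" if C: "C \<noteq> {}" "C \<subseteq> A'" for C
  proof -
    obtain c where c: "c \<in> C" "c \<in> X" using C sub by blast
    then have "A \<noteq> {}" using A by (auto simp: finite_approximation_def)
    then have "infdist c A = Min (dist c ` A)"
      using fin(1) by (simp add: infdist_notempty cInf_eq_Min)
    moreover have "Min (dist c ` A) \<in> dist c ` A"
      using fin(1) \<open>A \<noteq> {}\<close> by (intro Min_in) auto
    ultimately obtain a where "a \<in> A" "infdist c A = dist c a"
      by auto
    then have "a \<in> nearest_map A C"
      unfolding nearest_map_def nearest_points_def using c(1) by force
    then show ?thesis by blast
  qed
  have diam: "diameter (nearest_map A C) < 2 * \<epsilon>"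
    if C: "C \<noteq> {}" "C \<subseteq> A'" "diameter C < 2 * \<epsilon>'" for C
  proof -
    have "diameter (nearest_map A C) \<le> 2 * ?\<gamma> + diameter C"
    proof -
      have "dist a b \<le> 2 * ?\<gamma> + diameter C"
        if ab: "a \<in> nearest_map A C" "b \<in> nearest_map A C" for a b
      proof -
        from ab obtain c d where cd: "c \<in> C" "d \<in> C" "dist c a = infdist c A" "dist d b = infdist d A"
          by (auto simp: nearest_map_def nearest_points_def)
        have "dist c a \<le> ?\<gamma>" "dist d b \<le> ?\<gamma>"
          using infdist_le_approximation_radius[OF A] cd C(2) sub by auto
        moreover have "dist c d \<le> diameter C"
          using cd C(2) fin(2) by (meson diameter_bounded_bound finite_imp_bounded finite_subset)
        moreover have "dist a b \<le> dist c a + dist c d + dist d b"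
          using dist_triangle[of a b c] dist_triangle[of c b d] by (simp add: dist_commute)
        ultimately show ?thesis
          by linarith
      qed
      then have "(SUP (a, b) \<in> nearest_map A C \<times> nearest_map A C. dist a b) \<le> 2 * ?\<gamma> + diameter C"
        using nonempty[OF C(1,2)] by (intro cSUP_least) auto
      then show ?thesis
        using nonempty[OF C(1,2)] by (simp add: diameter_def)
    qed
    then show ?thesis
      using C(3) adj by (simp add: adjusted_def field_simps)
  qed
  have maps: "nearest_map A C \<in> topspace (finite_hyperspace A)"
    if "C \<noteq> {}" "C \<subseteq> A'" for C
    using nonempty[OF that]
    by (auto simp: topspace_finite_hyperspace nearest_map_def nearest_points_def)
  have "continuous_map (finite_hyperspace A') (finite_hyperspace A) (nearest_map A)"
    unfolding continuous_map_def
  proof (intro conjI allI impI)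
    show "nearest_map A \<in> topspace (finite_hyperspace A') \<rightarrow> topspace (finite_hyperspace A)"
      using maps by (auto simp: topspace_finite_hyperspace[of A'])
    fix U assume U: "openin (finite_hyperspace A) U"
    have "nearest_map A E \<in> U"
      if "nearest_map A D \<in> U" "D \<subseteq> A'" "E \<subseteq> D" "E \<noteq> {}" for D E
    proof -
      have "nearest_map A E \<subseteq> nearest_map A D" "nearest_map A E \<noteq> {}"
        using that nonempty[of E] by (auto simp: nearest_map_def)
      then show ?thesis
        using U that(1) unfolding openin_finite_hyperspace by blast
    qed
    then show "openin (finite_hyperspace A')
        {C \<in> topspace (finite_hyperspace A'). nearest_map A C \<in> U}"
      unfolding openin_finite_hyperspace topspace_finite_hyperspace by blast
  qed
  then show ?thesis
    unfolding small_hyperspace_def continuous_map_in_subtopology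
    using diam by (auto simp: continuous_map_from_subtopology topspace_finite_hyperspace)
qed

end

theory Submission
  imports Defs
begin

text \<open>
  A point \<open>(C\<^sub>n)\<close> of the limit of a finite approximative sequence is a thread of finite sets
  whose diameters tend to \<open>0\<close>, and it shrinks to a point of \<open>X\<close>. In general
  different threads may shrink to the same point, because a point of \<open>X\<close> can have several nearest
  points in \<open>A\<^sub>n\<close> while the points around it have fewer.

  Countability removes this ambiguity. Since \<open>\<epsilon>\<^sub>n\<^sub>+\<^sub>1\<close> is chosen after
  \<open>A\<^sub>n\<close>, it can be made much smaller than the distances between points of \<open>A\<^sub>n\<close>; and
  along an enumeration of \<open>X\<close> the sets \<open>A\<^sub>n\<close> can be chosen so that every point
  of \<open>X\<close> belongs to all but finitely many of them. Suppose that a thread shrinks to \<open>x\<close> and that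
  \<open>x \<in> A\<^sub>n\<close>. The set \<open>C\<^sub>n\<^sub>+\<^sub>1\<close> lies within \<open>2\<epsilon>\<^sub>n\<^sub>+\<^sub>1\<close> of \<open>x\<close>, where \<open>x\<close> is the only
  nearest point of \<open>A\<^sub>n\<close>, so \<open>C\<^sub>n = {x}\<close> (\<open>coordinate_eq_singleton\<close>). Hence the thread is
  eventually constant with value \<open>{x}\<close>, and its remaining coordinates are images of \<open>{x}\<close>: there is
  exactly one thread over each point (\<open>thread_shrinking_to\<close>, \<open>shrinks_to_imp_eq\<close>).

  The same estimate holds for threads over points close enough to \<open>x\<close>, so each coordinate of
  the thread over \<open>x\<close> is a locally constant function of \<open>x\<close>; this makes \<open>X \<rightarrow> \<X>\<close> continuous. The
  inverse is continuous because two threads whose \<open>n\<close>-th coordinates share a point shrink to points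
  at distance at most \<open>4\<epsilon>\<^sub>n\<close>.
\<close>

section \<open>Nearest points\<close>

lemma nearest_points_eq_singleton:
  assumes "x \<in> A" "dist c x < \<delta>" "\<And>b. b \<in> A \<Longrightarrow> b \<noteq> x \<Longrightarrow> 2 * \<delta> \<le> dist x b"
  shows "nearest_points A c = {x}"
proof -
  have far: "dist c x < dist c b" if "b \<in> A" "b \<noteq> x" for b
    using assms(2) assms(3)[OF that] dist_triangle[of x b c] by (simp add: dist_commute)
  have "infdist c A = dist c x"
  proof (rule antisym)
    show "infdist c A \<le> dist c x"
      using assms(1) by (rule infdist_le)
    have "dist c x \<le> dist c b" if "b \<in> A" for b
      using far[OF that] by (cases "b = x") auto
    then show "dist c x \<le> infdist c A"
      using assms(1) cINF_greatest[of A "dist c x" "dist c"] by (auto simp: infdist_def)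
  qed
  moreover have "dist c b = dist c x \<longleftrightarrow> b = x" if "b \<in> A" for b
    using far[OF that] by (cases "b = x") auto
  ultimately show ?thesis
    using assms(1) by (auto simp: nearest_points_def)
qed

lemma nearest_map_eq_singleton:
  assumes "C \<noteq> {}" "x \<in> A" "\<And>c. c \<in> C \<Longrightarrow> dist c x < \<delta>"
    and "\<And>b. b \<in> A \<Longrightarrow> b \<noteq> x \<Longrightarrow> 2 * \<delta> \<le> dist x b"
  shows "nearest_map A C = {x}"
proof -
  have "nearest_points A c = {x}" if "c \<in> C" for c
    using assms(2) assms(3)[OF that] assms(4) by (rule nearest_points_eq_singleton)
  then show ?thesis
    using assms(1) by (simp add: nearest_map_def)
qed

lemma nearest_map_singleton_self:
  assumes "x \<in> A"
  shows "nearest_map A {x} = {x}"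
  using assms by (auto simp: nearest_map_def nearest_points_def)

lemma approximation_radius_nonneg:
  assumes "finite_approximation \<epsilon> X A"
  shows "0 \<le> approximation_radius X A"
proof (cases "X = {}")
  case False
  then show ?thesis
    using infdist_le_approximation_radius[OF assms] infdist_nonneg order_trans by blast
qed (simp add: approximation_radius_def)

lemma approximation_radius_less:
  assumes "compact X" "finite_approximation \<epsilon> X A" "0 < \<epsilon>"
  shows "approximation_radius X A < \<epsilon>"
proof (cases "X = {}")
  case False
  have "continuous_on X (\<lambda>x. infdist x A)"
    by (intro continuous_intros)
  then obtain x where x: "x \<in> X" "\<And>y. y \<in> X \<Longrightarrow> infdist y A \<le> infdist x A"
    using continuous_attains_sup[OF assms(1) False] by blast
  obtain a where "a \<in> A" "dist x a < \<epsilon>"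
    using assms(2) x(1) by (auto simp: finite_approximation_def)
  then have "infdist x A < \<epsilon>"
    using infdist_le[of a A x] by simp
  moreover have "approximation_radius X A \<le> infdist x A"
    unfolding approximation_radius_def using x(2) by (intro cSup_least) (auto simp: infdist_nonneg)
  ultimately show ?thesis
    by simp
qed (use assms(3) in \<open>simp add: approximation_radius_def\<close>)

section \<open>Threads of a separated sequence\<close>

text \<open>The factor \<open>8\<close> makes \<open>4\<epsilon>\<^sub>n\<^sub>+\<^sub>1\<close> a radius within which a point of \<open>A\<^sub>n\<close> is the only nearest one.
  This covers the sets \<open>C\<^sub>n\<^sub>+\<^sub>1\<close> of threads over \<open>x\<close>, which lie within \<open>2\<epsilon>\<^sub>n\<^sub>+\<^sub>1\<close> of \<open>x\<close>, and leaves
  room for moving \<open>x\<close> itself by \<open>\<epsilon>\<^sub>n\<^sub>+\<^sub>1\<close>.\<close>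

locale separated_fas =
  fixes X :: "'a::metric_space set" and \<epsilon> :: "nat \<Rightarrow> real" and A :: "nat \<Rightarrow> 'a set"
  assumes compact: "compact X"
    and fas: "finite_approximative_sequence X \<epsilon> A"
    and separated: "a \<in> A n \<Longrightarrow> b \<in> A n \<Longrightarrow> a \<noteq> b \<Longrightarrow> 8 * \<epsilon> (Suc n) \<le> dist a b"
    and eventually_mem: "x \<in> X \<Longrightarrow> \<exists>k. \<forall>n\<ge>k. x \<in> A n"
begin

lemma eps_pos: "0 < \<epsilon> n"
  and eps_tendsto: "\<epsilon> \<longlonglongrightarrow> 0"
  and approx: "finite_approximation (\<epsilon> n) X (A n)"
  and adj: "adjusted X (\<epsilon> n) (A n) (\<epsilon> (Suc n))"
  using fas by (auto simp: finite_approximative_sequence_def)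

lemma A_subset: "A n \<subseteq> X"
  using approx[of n] by (simp add: finite_approximation_def)

lemma eps_Suc: "2 * \<epsilon> (Suc n) \<le> \<epsilon> n"
  using adj[of n] approximation_radius_nonneg[OF approx[of n]] by (simp add: adjusted_def)

lemma small_eps:
  assumes "0 < e"
  obtains n where "\<epsilon> n < e"
  using order_tendstoD(2)[OF eps_tendsto assms] by (meson eventually_sequentially order_refl)

lemma dist_nearest_point:
  assumes "c \<in> X" "a \<in> nearest_points (A n) c"
  shows "dist c a < \<epsilon> n"
proof -
  obtain b where "b \<in> A n" "dist c b < \<epsilon> n"
    using approx[of n] assms(1) by (auto simp: finite_approximation_def)
  then show ?thesis
    using assms(2) infdist_le[of b "A n" c] by (simp add: nearest_points_def)
qed

lemma topspace_fas_limit: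
  "C \<in> topspace (fas_limit \<epsilon> A) \<longleftrightarrow>
     (\<forall>n. C n \<noteq> {} \<and> C n \<subseteq> A n \<and> diameter (C n) < 2 * \<epsilon> n \<and> nearest_map (A n) (C (Suc n)) = C n)"
  by (auto simp: fas_limit_def inverse_limit_def small_hyperspace_def topspace_finite_hyperspace
      PiE_UNIV_domain Pi_iff)

definition shrinks_to :: "(nat \<Rightarrow> 'a set) \<Rightarrow> 'a \<Rightarrow> bool" where
  "shrinks_to C x \<longleftrightarrow> (\<forall>n. \<forall>c\<in>C n. dist c x \<le> 2 * \<epsilon> n)"

text \<open>A point within \<open>2\<epsilon>\<^sub>n\<^sub>+\<^sub>1 \<le> \<epsilon>\<^sub>n\<close> of all of \<open>C\<^sub>n\<^sub>+\<^sub>1\<close> is within \<open>2\<epsilon>\<^sub>n\<close> of all of \<open>C\<^sub>n\<close>, as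
  the bonding map moves points by less than \<open>\<epsilon>\<^sub>n\<close>. So the candidates for the point to which
  the thread shrinks form a nested sequence of compact sets, non-empty by the bound on the diameters.\<close>

lemma shrinks_to_exists:
  assumes C: "C \<in> topspace (fas_limit \<epsilon> A)"
  shows "\<exists>x\<in>X. shrinks_to C x"
proof -
  note C' = C[unfolded topspace_fas_limit, rule_format]
  define K where "K n = X \<inter> (\<Inter>c\<in>C n. cball c (2 * \<epsilon> n))" for n
  have "closedin (top_of_set X) (K n)" for n
    unfolding K_def by (intro closedin_closed_Int closed_INT) auto
  moreover have "K n \<noteq> {}" for n
  proof -
    obtain x where x: "x \<in> C n" using C'[of n] by blast
    have "bounded (C n)"
      using C'[of n] approx[of n] finite_subset
      by (metis finite_approximation_def finite_imp_bounded)
    then have "dist c x \<le> 2 * \<epsilon> n" if "c \<in> C n" for c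
      using diameter_bounded_bound[of "C n" c x] that x C'[of n] by linarith
    then have "x \<in> K n"
      unfolding K_def using x C'[of n] A_subset[of n] by auto
    then show ?thesis by blast
  qed
  moreover have "K (Suc n) \<subseteq> K n" for n
  proof
    fix x assume x: "x \<in> K (Suc n)"
    have "dist c x \<le> 2 * \<epsilon> n" if c: "c \<in> C n" for c
    proof -
      have "c \<in> nearest_map (A n) (C (Suc n))"
        using c C'[of n] by simp
      then obtain d where d: "d \<in> C (Suc n)" "c \<in> nearest_points (A n) d"
        unfolding nearest_map_def by blast
      then have "dist d c < \<epsilon> n"
        using dist_nearest_point C'[of "Suc n"] A_subset[of "Suc n"] by blast
      moreover have "dist d x \<le> 2 * \<epsilon> (Suc n)"
        using x d(1) by (auto simp: K_def)
      ultimately show ?thesis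
        using dist_triangle[of c x d] eps_Suc[of n] by (simp add: dist_commute)
    qed
    then show "x \<in> K n"
      using x by (auto simp: K_def)
  qed
  then have "decseq K"
    by (rule decseq_SucI)
  ultimately have "(\<Inter>n. K n) \<noteq> {}"
    using compact by (intro compact_space_imp_nest[of "top_of_set X"])
      (auto simp: compact_space_subtopology)
  then obtain x where "\<And>n. x \<in> K n"
    by blast
  then show ?thesis
    unfolding shrinks_to_def K_def by fastforce
qed

text \<open>The slack \<open>\<epsilon>\<^sub>n\<^sub>+\<^sub>1\<close> between \<open>x\<close> and \<open>y\<close> is what makes the coordinates locally constant below.\<close>

lemma coordinate_eq_singleton:
  assumes C: "C \<in> topspace (fas_limit \<epsilon> A)" and "shrinks_to C y"
    and "x \<in> A n" "dist x y < \<epsilon> (Suc n)"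
  shows "C n = {x}"
proof -
  have "dist c x < 4 * \<epsilon> (Suc n)" if "c \<in> C (Suc n)" for c
  proof -
    have "dist c y \<le> 2 * \<epsilon> (Suc n)"
      using assms(2) that by (auto simp: shrinks_to_def)
    then show ?thesis
      using dist_triangle[of c x y] assms(4) eps_pos[of "Suc n"] by (simp add: dist_commute)
  qed
  then have "nearest_map (A n) (C (Suc n)) = {x}"
    using C assms(3) separated[of x n]
    by (intro nearest_map_eq_singleton[where \<delta> = "4 * \<epsilon> (Suc n)"]) (auto simp: topspace_fas_limit)
  then show ?thesis
    using C by (simp add: topspace_fas_limit)
qed

lemma coordinate_eq_below:
  assumes "C \<in> topspace (fas_limit \<epsilon> A)" "D \<in> topspace (fas_limit \<epsilon> A)" "C m = D m" "n \<le> m"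
  shows "C n = D n"
  using assms(4,3)
proof (induction rule: inc_induct)
  case (step k)
  then show ?case
    using assms(1,2) unfolding topspace_fas_limit by metis
qed

lemma shrinks_to_imp_eq:
  assumes C: "C \<in> topspace (fas_limit \<epsilon> A)" "shrinks_to C x"
    and D: "D \<in> topspace (fas_limit \<epsilon> A)" "shrinks_to D x" and "x \<in> X"
  shows "C = D"
proof
  fix n
  obtain k where k: "\<forall>m\<ge>k. x \<in> A m"
    using eventually_mem[OF \<open>x \<in> X\<close>] by blast
  have "C (max n k) = D (max n k)"
    using coordinate_eq_singleton[OF C, of x] coordinate_eq_singleton[OF D, of x] k eps_pos by simp
  then show "C n = D n"
    by (rule coordinate_eq_below[OF C(1) D(1)]) simp
qed

text \<open>The composite of the bonding maps from stage \<open>n + j\<close> down to stage \<open>n\<close>.\<close>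

primrec bonding :: "nat \<Rightarrow> nat \<Rightarrow> 'a set \<Rightarrow> 'a set" where
  "bonding 0 n S = S"
| "bonding (Suc j) n S = nearest_map (A n) (bonding j (Suc n) S)"

lemma bonding_Suc_right: "bonding (Suc j) n S = bonding j n (nearest_map (A (n + j)) S)"
proof (induction j arbitrary: n)
  case (Suc j)
  from Suc[of "Suc n"] show ?case by simp
qed simp

lemma bonding_in_topspace:
  assumes "S \<in> topspace (small_hyperspace (2 * \<epsilon> (n + j)) (A (n + j)))"
  shows "bonding j n S \<in> topspace (small_hyperspace (2 * \<epsilon> n) (A n))"
  using assms
proof (induction j arbitrary: n)
  case (Suc j)
  then have "bonding j (Suc n) S \<in> topspace (small_hyperspace (2 * \<epsilon> (Suc n)) (A (Suc n)))"
    by simp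
  then show ?case
    using continuous_map_nearest_map[OF approx approx adj, of n]
    by (auto simp: continuous_map_def)
qed simp

text \<open>If \<open>x\<close> lies in \<open>A\<^sub>n\<close> for all \<open>n \<ge> k\<close>, then going down from stage \<open>n + k\<close> gives the \<open>n\<close>-th
  coordinate: the starting stage may be raised since \<open>{x}\<close> is fixed by the bonding maps there.\<close>

lemma thread_shrinking_to:
  assumes "x \<in> X"
  shows "\<exists>C \<in> topspace (fas_limit \<epsilon> A). shrinks_to C x"
proof -
  obtain k where k: "\<forall>n\<ge>k. x \<in> A n"
    using eventually_mem[OF assms] by blast
  define C where "C n = bonding k n {x}" for n
  have "{x} \<in> topspace (small_hyperspace (2 * \<epsilon> (n + k)) (A (n + k)))" for n
    using k eps_pos[of "n + k"] by (simp add: small_hyperspace_def topspace_finite_hyperspace)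
  then have "C n \<in> topspace (small_hyperspace (2 * \<epsilon> n) (A n))" for n
    unfolding C_def by (rule bonding_in_topspace)
  moreover have "nearest_map (A n) (C (Suc n)) = C n" for n
    using bonding_Suc_right[of k n "{x}"] nearest_map_singleton_self[of x "A (n + k)"] k
    by (simp add: C_def)
  ultimately have C: "C \<in> topspace (fas_limit \<epsilon> A)"
    by (simp add: topspace_fas_limit small_hyperspace_def topspace_finite_hyperspace)
  then obtain y where y: "y \<in> X" "shrinks_to C y"
    using shrinks_to_exists by blast
  obtain l where l: "\<forall>n\<ge>l. y \<in> A n"
    using eventually_mem[OF y(1)] by blast
  have "bonding j n {x} = {x}" if "n \<ge> k" for j n
    using that k by (induction j arbitrary: n) (auto simp: nearest_map_singleton_self)
  then have "C (max k l) = {x}"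
    by (simp add: C_def)
  moreover have "C (max k l) = {y}"
    using coordinate_eq_singleton[OF C y(2)] l eps_pos by simp
  ultimately show ?thesis
    using C y(2) by auto
qed

section \<open>The homeomorphism\<close>

definition thread_over :: "'a \<Rightarrow> nat \<Rightarrow> 'a set" where
  "thread_over x = (SOME C. C \<in> topspace (fas_limit \<epsilon> A) \<and> shrinks_to C x)"

definition limit_point :: "(nat \<Rightarrow> 'a set) \<Rightarrow> 'a" where
  "limit_point C = (SOME x. x \<in> X \<and> shrinks_to C x)"

lemma thread_over:
  assumes "x \<in> X"
  shows "thread_over x \<in> topspace (fas_limit \<epsilon> A)" "shrinks_to (thread_over x) x"
  using someI_ex[OF thread_shrinking_to[OF assms, unfolded Bex_def]] by (simp_all add: thread_over_def)

lemma limit_point: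
  assumes "C \<in> topspace (fas_limit \<epsilon> A)"
  shows "limit_point C \<in> X" "shrinks_to C (limit_point C)"
  using someI_ex[OF shrinks_to_exists[OF assms, unfolded Bex_def]] by (simp_all add: limit_point_def)

lemma dist_shrinking_points:
  assumes "shrinks_to C x" "shrinks_to D y" "c \<in> C n" "c \<in> D n"
  shows "dist x y \<le> 4 * \<epsilon> n"
proof -
  have "dist c x \<le> 2 * \<epsilon> n" "dist c y \<le> 2 * \<epsilon> n"
    using assms by (auto simp: shrinks_to_def)
  then show ?thesis
    using dist_triangle3[of x y c] by simp
qed

lemma shrinks_to_unique:
  assumes "C \<in> topspace (fas_limit \<epsilon> A)" "shrinks_to C x" "shrinks_to C y"
  shows "x = y"
proof (rule ccontr)
  assume "x \<noteq> y"
  then obtain n where n: "\<epsilon> n < dist x y / 4"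
    using small_eps[of "dist x y / 4"] by auto
  obtain c where "c \<in> C n"
    using assms(1) unfolding topspace_fas_limit by blast
  then have "dist x y \<le> 4 * \<epsilon> n"
    using dist_shrinking_points[OF assms(2,3)] by blast
  then show False
    using n by simp
qed

lemma thread_over_coordinate_locally_constant:
  assumes "x \<in> X"
  shows "\<exists>\<delta>>0. \<forall>y\<in>X. dist x y < \<delta> \<longrightarrow> thread_over y n = thread_over x n"
proof -
  obtain k where k: "\<forall>n\<ge>k. x \<in> A n"
    using eventually_mem[OF assms] by blast
  let ?m = "max n k"
  have *: "thread_over y ?m = {x}" if "y \<in> X" "dist x y < \<epsilon> (Suc ?m)" for y
    using coordinate_eq_singleton[OF thread_over[OF that(1)]] that(2) k by simp
  have "thread_over y n = thread_over x n" if "y \<in> X" "dist x y < \<epsilon> (Suc ?m)" for y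
  proof (rule coordinate_eq_below)
    show "thread_over y ?m = thread_over x ?m"
      using *[OF that] *[OF assms] eps_pos by simp
  qed (use that(1) assms in \<open>simp_all add: thread_over(1)\<close>)
  then show ?thesis
    using eps_pos[of "Suc ?m"] by blast
qed

lemma continuous_thread_over: "continuous_map (top_of_set X) (fas_limit \<epsilon> A) thread_over"
  unfolding fas_limit_def inverse_limit_def continuous_map_in_subtopology
    continuous_map_componentwise_UNIV
proof (intro conjI allI)
  show "thread_over \<in> topspace (top_of_set X) \<rightarrow> {C. \<forall>n. nearest_map (A n) (C (Suc n)) = C n}"
    using thread_over(1) by (auto simp: topspace_fas_limit)
  fix n
  show "continuous_map (top_of_set X) (small_hyperspace (2 * \<epsilon> n) (A n)) (\<lambda>x. thread_over x n)"
    unfolding continuous_map_def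
  proof (intro conjI allI impI)
    show "(\<lambda>x. thread_over x n) \<in> topspace (top_of_set X) \<rightarrow> topspace (small_hyperspace (2 * \<epsilon> n) (A n))"
      using thread_over(1)
      by (auto simp: topspace_fas_limit small_hyperspace_def topspace_finite_hyperspace)
    fix U
    have "\<exists>\<delta>>0. \<forall>y\<in>X. dist y x < \<delta> \<longrightarrow> thread_over y n \<in> U"
      if x: "x \<in> X" "thread_over x n \<in> U" for x
    proof -
      obtain \<delta> where "0 < \<delta>" "\<forall>y\<in>X. dist x y < \<delta> \<longrightarrow> thread_over y n = thread_over x n"
        using thread_over_coordinate_locally_constant[OF x(1)] by blast
      then show ?thesis
        using x(2) by (intro exI[of _ \<delta>]) (simp add: dist_commute)
    qed
    then show "openin (top_of_set X) {x \<in> topspace (top_of_set X). thread_over x n \<in> U}"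
      by (auto simp: openin_euclidean_subtopology_iff)
  qed
qed

text \<open>In the upper semifinite topology the smallest neighbourhood of a finite set consists of its
  subsets, so prescribing an upper bound for a coordinate is an open condition, while prescribing
  its value need not be.\<close>

lemma openin_fas_limit_below:
  "openin (fas_limit \<epsilon> A) {D \<in> topspace (fas_limit \<epsilon> A). D n \<subseteq> S}"
proof -
  let ?T = "small_hyperspace (2 * \<epsilon> n) (A n)"
  have "openin (finite_hyperspace (A n)) {E \<in> Pow (A n) - {{}}. E \<subseteq> S}"
    by (auto simp: openin_finite_hyperspace)
  then have "openin ?T {E \<in> topspace ?T. E \<subseteq> S}"
    unfolding small_hyperspace_def openin_subtopology
    by (intro exI conjI) (auto simp: topspace_finite_hyperspace)
  moreover have "continuous_map (fas_limit \<epsilon> A) ?T (\<lambda>D. D n)"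
    unfolding fas_limit_def inverse_limit_def
    by (intro continuous_map_from_subtopology continuous_map_product_projection) simp
  ultimately have "openin (fas_limit \<epsilon> A)
      {D \<in> topspace (fas_limit \<epsilon> A). D n \<in> {E \<in> topspace ?T. E \<subseteq> S}}"
    by (rule openin_continuous_map_preimage[rotated])
  moreover have "{D \<in> topspace (fas_limit \<epsilon> A). D n \<in> {E \<in> topspace ?T. E \<subseteq> S}} =
      {D \<in> topspace (fas_limit \<epsilon> A). D n \<subseteq> S}"
    by (auto simp: topspace_fas_limit small_hyperspace_def topspace_finite_hyperspace)
  ultimately show ?thesis by simp
qed

lemma continuous_limit_point: "continuous_map (fas_limit \<epsilon> A) (top_of_set X) limit_point"
  unfolding continuous_map_in_subtopology
proof (intro conjI)
  show "limit_point \<in> topspace (fas_limit \<epsilon> A) \<rightarrow> X"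
    using limit_point(1) by blast
  show "continuous_map (fas_limit \<epsilon> A) euclidean limit_point"
    unfolding continuous_map_def
  proof (intro conjI allI impI)
    fix U :: "'a set" assume "openin euclidean U"
    then have U: "open U" by simp
    show "openin (fas_limit \<epsilon> A) {C \<in> topspace (fas_limit \<epsilon> A). limit_point C \<in> U}"
    proof (subst openin_subopen, intro ballI)
      fix C assume "C \<in> {C \<in> topspace (fas_limit \<epsilon> A). limit_point C \<in> U}"
      then have C: "C \<in> topspace (fas_limit \<epsilon> A)" and CU: "limit_point C \<in> U" by auto
      obtain e where e: "e > 0" "\<And>y. dist y (limit_point C) < e \<Longrightarrow> y \<in> U"
        using U CU by (meson open_dist)
      obtain n where n: "\<epsilon> n < e / 4"
        using small_eps[of "e / 4"] e(1) by auto
      have "limit_point D \<in> U" if D: "D \<in> topspace (fas_limit \<epsilon> A)" "D n \<subseteq> C n" for D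
      proof -
        have "D n \<noteq> {}"
          using D(1) unfolding topspace_fas_limit by blast
        then obtain c where "c \<in> D n" "c \<in> C n"
          using D(2) by blast
        then have "dist (limit_point D) (limit_point C) \<le> 4 * \<epsilon> n"
          using dist_shrinking_points limit_point(2) D(1) C by blast
        then show ?thesis
          using n by (intro e(2)) linarith
      qed
      then show "\<exists>T. openin (fas_limit \<epsilon> A) T \<and> C \<in> T \<and>
          T \<subseteq> {C \<in> topspace (fas_limit \<epsilon> A). limit_point C \<in> U}"
        using C openin_fas_limit_below[of n "C n"]
        by (intro exI[of _ "{D \<in> topspace (fas_limit \<epsilon> A). D n \<subseteq> C n}"]) auto
    qed
  qed simp
qed

theorem fas_limit_homeomorphic: "fas_limit \<epsilon> A homeomorphic_space top_of_set X"
proof -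
  have "thread_over (limit_point C) = C" if "C \<in> topspace (fas_limit \<epsilon> A)" for C
    using shrinks_to_imp_eq thread_over limit_point that by blast
  moreover have "limit_point (thread_over x) = x" if "x \<in> X" for x
    using shrinks_to_unique thread_over limit_point that by blast
  ultimately have "homeomorphic_maps (fas_limit \<epsilon> A) (top_of_set X) limit_point thread_over"
    by (simp add: homeomorphic_maps_def continuous_limit_point continuous_thread_over)
  then show ?thesis
    by (auto simp: homeomorphic_space_def)
qed

end

section \<open>Existence of a separated sequence\<close>

lemma finite_approximation_exists:
  assumes "compact X" "0 < \<epsilon>" "finite F" "F \<subseteq> X"
  shows "\<exists>A. finite_approximation \<epsilon> X A \<and> F \<subseteq> A"
proof -
  have "X \<subseteq> (\<Union>x\<in>X. ball x \<epsilon>)"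
    using assms(2) by auto
  then obtain K where K: "K \<subseteq> X" "finite K" "X \<subseteq> (\<Union>x\<in>K. ball x \<epsilon>)"
    using compactE_image[OF assms(1)] open_ball by metis
  have "\<exists>a \<in> K \<union> F. dist x a < \<epsilon>" if "x \<in> X" for x
    using K(3) that by (fastforce simp: dist_commute)
  then have "finite_approximation \<epsilon> X (K \<union> F)"
    using K(1,2) assms(3,4) unfolding finite_approximation_def by simp
  then show ?thesis by blast
qed

lemma finite_imp_uniform_discrete:
  assumes "finite S"
  shows "uniform_discrete S"
  using assms by (induction rule: finite_induct) (simp_all add: uniform_discrete_insert)

text \<open>In the recursive choice, \<open>A\<^sub>n\<close> is already given when \<open>\<epsilon>\<^sub>n\<^sub>+\<^sub>1\<close> is chosen. Being adjusted to
  \<open>A\<^sub>n\<close>, being small against the separation of \<open>A\<^sub>n\<close> and tending to \<open>0\<close> are all upper bounds on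
  \<open>\<epsilon>\<^sub>n\<^sub>+\<^sub>1\<close>, and they are positive: the first by compactness of \<open>X\<close>, the second by finiteness of
  \<open>A\<^sub>n\<close>. Afterwards \<open>A\<^sub>n\<^sub>+\<^sub>1\<close> may be enlarged by any finite subset of \<open>X\<close>, in
  particular by an initial segment of an enumeration.\<close>

lemma separated_fas_exists:
  fixes X :: "'a::metric_space set"
  assumes "compact X" "countable X"
  shows "\<exists>\<epsilon> A. separated_fas X \<epsilon> A"
proof -
  define F where "F n = {x \<in> X. to_nat_on X x \<le> n}" for n
  have F: "finite (F n)" "F n \<subseteq> X" for n
  proof -
    have "inj_on (to_nat_on X) (F n)"
      using inj_on_to_nat_on[OF assms(2)] by (auto simp: F_def inj_on_def)
    then show "finite (F n)"
      by (rule inj_on_finite[of _ _ "{..n}"]) (auto simp: F_def)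
  qed (auto simp: F_def)
  define P where "P n s \<longleftrightarrow> 0 < fst s \<and> fst s \<le> inverse (real (Suc n)) \<and>
    finite_approximation (fst s) X (snd s) \<and> F n \<subseteq> snd s" for n and s :: "real \<times> 'a set"
  define Q where "Q s t \<longleftrightarrow> adjusted X (fst s) (snd s) (fst t) \<and>
    (\<forall>a\<in>snd s. \<forall>b\<in>snd s. a \<noteq> b \<longrightarrow> 8 * fst t \<le> dist a b)" for s t :: "real \<times> 'a set"
  have "\<exists>s. P 0 s"
  proof -
    obtain A where "finite_approximation 1 X A" "F 0 \<subseteq> A"
      using finite_approximation_exists[OF assms(1) zero_less_one F] by blast
    then have "P 0 (1, A)"
      by (simp add: P_def)
    then show ?thesis ..
  qed
  moreover have "\<exists>t. P (Suc n) t \<and> Q s t" if s: "P n s" for n s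
  proof -
    have "uniform_discrete (snd s)"
      using s by (simp add: P_def finite_approximation_def finite_imp_uniform_discrete)
    then obtain \<delta> where \<delta>: "\<delta> > 0" "\<forall>a\<in>snd s. \<forall>b\<in>snd s. a \<noteq> b \<longrightarrow> \<delta> \<le> dist a b"
      unfolding uniform_discrete_def by (meson not_le)
    define g where "g = (fst s - approximation_radius X (snd s)) / 2"
    have g: "0 < g" "g < fst s"
    proof -
      have "finite_approximation (fst s) X (snd s)" "0 < fst s"
        using s by (simp_all add: P_def)
      then have "approximation_radius X (snd s) < fst s" "0 \<le> approximation_radius X (snd s)"
        using approximation_radius_less assms(1) approximation_radius_nonneg by metis+
      then show "0 < g" "g < fst s"
        using \<open>0 < fst s\<close> by (simp_all add: g_def)
    qed
    \<comment> \<open>Halving \<open>g\<close> makes the inequality that \<open>adjusted\<close> asks for strict.\<close>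
    define e where "e = min (g / 2) (min (\<delta> / 8) (inverse (real (Suc (Suc n)))))"
    have "0 < inverse (real (Suc (Suc n)))"
      by simp
    then have e: "0 < e" "e < g" "8 * e \<le> \<delta>" "e \<le> inverse (real (Suc (Suc n)))"
      using g \<delta>(1) unfolding e_def by linarith+
    obtain B where "finite_approximation e X B" "F (Suc n) \<subseteq> B"
      using finite_approximation_exists[OF assms(1) e(1) F] by blast
    then have "P (Suc n) (e, B)"
      using e by (simp add: P_def)
    moreover have "adjusted X (fst s) (snd s) e"
      using e g by (simp add: adjusted_def g_def)
    moreover have "\<forall>a\<in>snd s. \<forall>b\<in>snd s. a \<noteq> b \<longrightarrow> 8 * e \<le> dist a b"
      using e(3) \<delta>(2) order_trans by blast
    ultimately show ?thesis
      by (intro exI[of _ "(e, B)"]) (simp add: Q_def)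
  qed
  ultimately obtain s where s: "\<And>n. P n (s n)" "\<And>n. Q (s n) (s (Suc n))"
    using dependent_nat_choice[of P "\<lambda>_. Q"] by metis
  have s': "0 < fst (s n)" "fst (s n) \<le> inverse (real (Suc n))"
      "finite_approximation (fst (s n)) X (snd (s n))" "F n \<subseteq> snd (s n)" for n
    using s(1)[of n] by (simp_all add: P_def)
  have "(\<lambda>n. fst (s n)) \<longlonglongrightarrow> 0"
    by (rule real_tendsto_sandwich[OF _ _ tendsto_const LIMSEQ_inverse_real_of_nat])
      (simp_all add: s' less_imp_le del: of_nat_Suc)
  then have fas: "finite_approximative_sequence X (\<lambda>n. fst (s n)) (\<lambda>n. snd (s n))"
    using s(2) s' by (simp add: finite_approximative_sequence_def Q_def)
  have "separated_fas X (\<lambda>n. fst (s n)) (\<lambda>n. snd (s n))"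
  proof
    show "8 * fst (s (Suc n)) \<le> dist a b" if "a \<in> snd (s n)" "b \<in> snd (s n)" "a \<noteq> b" for a b n
      using s(2)[of n] that by (simp add: Q_def)
    show "\<exists>k. \<forall>n\<ge>k. x \<in> snd (s n)" if "x \<in> X" for x
    proof (intro exI allI impI)
      fix n assume "to_nat_on X x \<le> n"
      then have "x \<in> F n"
        using that by (simp add: F_def)
      then show "x \<in> snd (s n)"
        using s'(4) by blast
    qed
  qed (fact assms(1) fas)+
  then show ?thesis by blast
qed

theorem proposition8:
  fixes X :: "'a::metric_space set"
  assumes "compact X" and "countable X"
  shows "\<exists>\<epsilon> A. finite_approximative_sequence X \<epsilon> A \<and>
           fas_limit \<epsilon> A homeomorphic_space top_of_set X"
proof -
  obtain \<epsilon> A where "separated_fas X \<epsilon> A"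
    using separated_fas_exists[OF assms] by blast
  then interpret separated_fas X \<epsilon> A .
  show ?thesis
    using fas fas_limit_homeomorphic by (intro exI conjI)
qed

end
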